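(* There is an absolute constant $C>0$ such that the following holds for all positive integers $M_1,N_1,M_2,N_2$. Let $S$ be the set of pairs $(A,B)\in\mathbb{Z}^2$ such that $M_1\le |A|\le M_1+N_1$, $M_2\le |B|\le M_2+N_2$, the equation $y^2=x^3+Ax+B$ defines an elliptic curve $E$ over $\mathbb{Q}$, and $E[3](\mathbb{Q})\ne\{0_E\}$. Then \[ \# S\le C\,\frac{N_1N_2}{\sqrt{\min\{N_1,N_2\}}}. \]
   Context: $E[3](\mathbb{Q})$ denotes the group of $\mathbb{Q}$-rational points of $E$ killed by $3$, and $0_E$ is the identity element. *)

theory Defs
  imports Complex_Main
begin

definition ec_discriminant :: "'a::field \<Rightarrow> 'a \<Rightarrow> 'a" where
  "ec_discriminant A B = - 16 * (4 * A ^ 3 + 27 * B ^ 2)"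

definition defines_elliptic_curve :: "rat \<Rightarrow> rat \<Rightarrow> bool" where
  "defines_elliptic_curve A B \<longleftrightarrow> ec_discriminant A B \<noteq> 0"

text \<open>
  A nonvanishing discriminant means that the curve \<open>y\<^sup>2 = x\<^sup>3 + A x + B\<close> has no singular
  point over the complex numbers, i.e. no point at which both partial derivatives of
  \<open>y\<^sup>2 - (x\<^sup>3 + A x + B)\<close> vanish; the point at infinity is always smooth.
\<close>

lemma defines_elliptic_curve_iff_smooth:
  "defines_elliptic_curve A B \<longleftrightarrow>
    (\<nexists>x y :: complex. y ^ 2 = x ^ 3 + of_rat A * x + of_rat B \<and>
       3 * x ^ 2 + of_rat A = 0 \<and> 2 * y = 0)"
proof -
  let ?a = "of_rat A :: complex" and ?b = "of_rat B :: complex"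
  have "of_rat (4 * A ^ 3 + 27 * B ^ 2) = 4 * ?a ^ 3 + 27 * ?b ^ 2"
    by (simp add: of_rat_add of_rat_mult of_rat_power)
  then have disc: "4 * A ^ 3 + 27 * B ^ 2 = 0 \<longleftrightarrow> 4 * ?a ^ 3 + 27 * ?b ^ 2 = 0"
    by (metis of_rat_eq_0_iff)
  have "4 * ?a ^ 3 + 27 * ?b ^ 2 = 0"
    if "x ^ 3 + ?a * x + ?b = 0" "3 * x ^ 2 + ?a = 0" for x :: complex
  proof -
    have a: "?a = - 3 * x ^ 2" using that(2) by algebra
    have b: "?b = 2 * x ^ 3" using that(1) a by algebra
    show ?thesis unfolding a b by algebra
  qed
  moreover have "\<exists>x :: complex. x ^ 3 + ?a * x + ?b = 0 \<and> 3 * x ^ 2 + ?a = 0"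
    if d: "4 * ?a ^ 3 + 27 * ?b ^ 2 = 0"
  proof (cases "?a = 0")
    case True
    then show ?thesis using d by (intro exI[of _ 0]) simp
  next
    case False
    define x where "x = - 3 * ?b / (2 * ?a)"
    have x: "2 * ?a * x = - 3 * ?b" using False by (simp add: x_def)
    have "4 * ?a ^ 2 * (3 * x ^ 2 + ?a) = 0" using x d by algebra
    then have "3 * x ^ 2 + ?a = 0" using False by simp
    moreover from this have "x ^ 3 + ?a * x + ?b = 0" using x by algebra
    ultimately show ?thesis by blast
  qed
  ultimately show ?thesis
    unfolding defines_elliptic_curve_def ec_discriminant_def using disc by auto
qed

datatype 'a ec_point = Infinity | Affine 'a 'a

definition ec_points :: "'a::field \<Rightarrow> 'a \<Rightarrow> 'a ec_point set" where
  "ec_points A B = insert Infinity {Affine x y | x y. y ^ 2 = x ^ 3 + A * x + B}"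

text \<open>
  Chord and tangent law on \<open>y\<^sup>2 = x\<^sup>3 + A x + B\<close>; it does not mention \<open>B\<close>. For two points of
  the curve, \<open>x1 = x2\<close> and \<open>y1 \<noteq> - y2\<close> imply that the points coincide and \<open>y1 \<noteq> 0\<close>, so
  the tangent slope is used exactly for doublings.
\<close>

fun ec_add :: "'a::field \<Rightarrow> 'a ec_point \<Rightarrow> 'a ec_point \<Rightarrow> 'a ec_point" where
  "ec_add A Infinity Q = Q"
| "ec_add A P Infinity = P"
| "ec_add A (Affine x1 y1) (Affine x2 y2) =
    (if x1 = x2 \<and> y1 = - y2 then Infinity
     else
       let m = (if x1 = x2 then (3 * x1 ^ 2 + A) / (2 * y1) else (y2 - y1) / (x2 - x1));
           x3 = m ^ 2 - x1 - x2
       in Affine x3 (m * (x1 - x3) - y1))"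

primrec ec_mult :: "'a::field \<Rightarrow> nat \<Rightarrow> 'a ec_point \<Rightarrow> 'a ec_point" where
  "ec_mult A 0 P = Infinity"
| "ec_mult A (Suc n) P = ec_add A P (ec_mult A n P)"

definition ec_torsion :: "'a::field \<Rightarrow> 'a \<Rightarrow> nat \<Rightarrow> 'a ec_point set" where
  "ec_torsion A B n = {P \<in> ec_points A B. ec_mult A n P = Infinity}"

lemma ec_add_closed:
  fixes A B :: "'a::field_char_0"
  assumes "P \<in> ec_points A B" "Q \<in> ec_points A B"
  shows "ec_add A P Q \<in> ec_points A B"
proof (cases "P = Infinity \<or> Q = Infinity")
  case True
  then show ?thesis using assms by (cases P; cases Q) auto
next
  case False
  then obtain x1 y1 x2 y2 where PQ: "P = Affine x1 y1" "Q = Affine x2 y2"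
    by (metis ec_point.exhaust)
  have e1: "y1 ^ 2 = x1 ^ 3 + A * x1 + B" and e2: "y2 ^ 2 = x2 ^ 3 + A * x2 + B"
    using assms by (auto simp: PQ ec_points_def)
  show ?thesis
  proof (cases "x1 = x2")
    case True
    show ?thesis
    proof (cases "y1 = - y2")
      case True
      then show ?thesis using \<open>x1 = x2\<close> by (simp add: PQ ec_points_def)
    next
      case False
      have "y1 = y2" using e1 e2 True False by algebra
      then have "y1 \<noteq> 0" using False by auto
      define m where "m = (3 * x1 ^ 2 + A) / (2 * y1)"
      have m: "2 * y1 * m = 3 * x1 ^ 2 + A" using \<open>y1 \<noteq> 0\<close> by (simp add: m_def)
      have "(m * (x1 - (m ^ 2 - x1 - x2)) - y1) ^ 2 =
          (m ^ 2 - x1 - x2) ^ 3 + A * (m ^ 2 - x1 - x2) + B"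
        using m e1 True by algebra
      then show ?thesis
        using True False by (simp add: PQ ec_points_def Let_def m_def)
    qed
  next
    case False
    define m where "m = (y2 - y1) / (x2 - x1)"
    have m: "m * (x2 - x1) = y2 - y1" using False by (simp add: m_def)
    have "(x2 - x1) * ((m * (x1 - (m ^ 2 - x1 - x2)) - y1) ^ 2) =
        (x2 - x1) * ((m ^ 2 - x1 - x2) ^ 3 + A * (m ^ 2 - x1 - x2) + B)"
      using m e1 e2 by algebra
    then have "(m * (x1 - (m ^ 2 - x1 - x2)) - y1) ^ 2 =
        (m ^ 2 - x1 - x2) ^ 3 + A * (m ^ 2 - x1 - x2) + B"
      using False by simp
    then show ?thesis
      using False by (simp add: PQ ec_points_def Let_def m_def)
  qed
qed

end

theory Submission
  imports Defs
begin

text \<open>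
  A point \<open>(x, y)\<close> of order 3 is a flex: the tangent slope \<open>m\<close> there satisfies \<open>m\<^sup>2 = 3 x\<close>.
  Eliminating \<open>x\<close> and \<open>y\<close> gives \<open>m\<^sup>8 + 18 A m\<^sup>4 + 108 B m\<^sup>2 - 27 A\<^sup>2 = 0\<close>, which is monic in \<open>m\<close>, so
  \<open>m\<close> is an integer, and it is nonzero if \<open>A \<noteq> 0\<close>. For fixed \<open>A\<close> the equation determines \<open>B\<close> from
  \<open>m\<^sup>2\<close>, and two slopes \<open>0 < p < q\<close> with corresponding values \<open>B\<close> and \<open>B'\<close> satisfy
  \<open>108 (B - B') \<ge> (q\<^sup>2 - p\<^sup>2)\<^sup>3 \<ge> q\<^sup>2\<close>. Hence an interval of length \<open>N\<^sub>2\<close> contains \<open>O(\<surd>N\<^sub>2)\<close> admissible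
  \<open>B\<close>, and summing over \<open>A\<close> gives \<open>O(N\<^sub>1 \<surd>N\<^sub>2)\<close> pairs.
\<close>

text \<open>The 3-division polynomial \<open>3 x^4 + 6 A x^2 + 12 B x - A^2\<close>, times 27,
  vanishes at \<open>x = m^2 / 3\<close>. One predicate serves both rationals and integers.\<close>

definition flex_slope_eq :: "'a::comm_ring_1 \<Rightarrow> 'a \<Rightarrow> 'a \<Rightarrow> bool" where
  "flex_slope_eq A B m \<longleftrightarrow> m ^ 8 + 18 * A * m ^ 4 + 108 * B * m ^ 2 = 27 * A ^ 2"

lemma flex_slope_eq_if_torsion3:
  fixes A B :: "'a::field_char_0"
  assumes "ec_torsion A B 3 \<noteq> {Infinity}"
  obtains m where "flex_slope_eq A B m"
proof -
  have "Infinity \<in> ec_torsion A B 3"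
    by (simp add: ec_torsion_def ec_points_def numeral_3_eq_3)
  then obtain P where P: "P \<in> ec_torsion A B 3" "P \<noteq> Infinity"
    using assms by blast
  then obtain x y where xy: "P = Affine x y" "y ^ 2 = x ^ 3 + A * x + B"
    by (auto simp: ec_torsion_def ec_points_def)
  have trip: "ec_add A P (ec_add A P P) = Infinity"
    using P(1) by (simp add: ec_torsion_def numeral_3_eq_3 xy(1))
  \<comment> \<open>If \<open>y = 0\<close>, then \<open>2P = Infinity\<close> and
    \<open>3P = P\<close>.\<close>
  have y0: "y \<noteq> 0"
    using trip by (auto simp: xy(1))
  then have "y \<noteq> - y" by simp
  define m where "m = (3 * x ^ 2 + A) / (2 * y)"
  have m: "2 * y * m = 3 * x ^ 2 + A"
    using y0 by (simp add: m_def)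
  \<comment> \<open>\<open>2P = -P\<close>, so doubling preserves the x-coordinate.\<close>
  have "x = m ^ 2 - x - x"
    using trip \<open>y \<noteq> - y\<close> by (auto simp: xy(1) Let_def m_def split: if_splits)
  then have x: "m ^ 2 = 3 * x" by (simp add: algebra_simps)
  have "3 * x ^ 4 + 6 * A * x ^ 2 + 12 * B * x = A ^ 2"
    using m x xy(2) by algebra
  then have "flex_slope_eq A B m"
    unfolding flex_slope_eq_def using x by algebra
  then show ?thesis by (rule that)
qed

lemma flex_slope_eq_imp_integer:
  fixes A B :: int and m :: rat
  assumes "flex_slope_eq (of_int A) (of_int B) m"
  obtains k :: int where "m = of_int k"
proof -
  obtain a b where m: "m = Fract a b" "b > 0" "coprime a b"
    by (cases m) blast
  have mb: "m * of_int b = of_int a"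
    using m(1,2) by (simp add: Fract_of_int_quotient)
  have "(of_int (a ^ 8 + 18 * A * a ^ 4 * b ^ 4 + 108 * B * a ^ 2 * b ^ 6) :: rat)
      = of_int (27 * A ^ 2 * b ^ 8)"
    using assms unfolding flex_slope_eq_def by (simp flip: mb) algebra
  then have "a ^ 8 + 18 * A * a ^ 4 * b ^ 4 + 108 * B * a ^ 2 * b ^ 6 = 27 * A ^ 2 * b ^ 8"
    unfolding of_int_eq_iff .
  \<comment> \<open>Rational root argument: with denominators cleared, every term but
    \<open>a ^ 8\<close> contains \<open>b\<close>.\<close>
  then have "a ^ 8 = b * (27 * A ^ 2 * b ^ 7 - 18 * A * a ^ 4 * b ^ 3 - 108 * B * a ^ 2 * b ^ 5)"
    by algebra
  then have "b dvd a ^ 8" by (metis dvd_triv_left)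
  moreover have "coprime b (a ^ 8)"
    using m(3) by (simp add: coprime_commute)
  ultimately have "is_unit b"
    using coprime_absorb_left by blast
  then have "b = 1" using m(2) by simp
  then show ?thesis using mb by (intro that[of a]) simp
qed

lemma flex_slope_eq_torsion3_nat:
  fixes A B :: int
  assumes "ec_torsion (rat_of_int A) (rat_of_int B) 3 \<noteq> {Infinity}" "A \<noteq> 0"
  obtains m :: nat where "m > 0" "flex_slope_eq A B (int m)"
proof -
  obtain r where r: "flex_slope_eq (rat_of_int A) (rat_of_int B) r"
    using assms(1) by (rule flex_slope_eq_if_torsion3)
  then obtain k where k: "r = of_int k" by (rule flex_slope_eq_imp_integer)
  have "rat_of_int (k ^ 8 + 18 * A * k ^ 4 + 108 * B * k ^ 2) = of_int (27 * A ^ 2)"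
    using r by (simp add: flex_slope_eq_def k)
  then have eq: "flex_slope_eq A B k"
    unfolding of_int_eq_iff flex_slope_eq_def .
  then have "k \<noteq> 0" using assms(2) by (auto simp: flex_slope_eq_def)
  moreover have "flex_slope_eq A B (int (nat \<bar>k\<bar>))"
    using eq by (simp add: flex_slope_eq_def)
  ultimately show ?thesis by (intro that[of "nat \<bar>k\<bar>"]) auto
qed

text \<open>With \<open>t = m^2\<close>, \<open>108 B = 27 A^2 / t - 18 A t - t^3\<close> has
  derivative \<open>- 3 (3 A / t + t)^2\<close> in \<open>t\<close>, so \<open>B\<close> falls as
  the slope grows. The bound is a quantitative form of this.\<close>

lemma flex_slope_gap:
  fixes A B B' p q :: int
  assumes "flex_slope_eq A B p" "flex_slope_eq A B' q" "0 < p" "p < q"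
  shows "q ^ 2 \<le> 108 * (B - B')"
proof -
  define d where "d = q ^ 2 - p ^ 2"
  have "(p + 1) * q \<le> q * q" using assms by (intro mult_right_mono) auto
  moreover have "p * p \<le> p * q" using assms by (intro mult_left_mono) auto
  ultimately have dq: "q \<le> d"
    by (simp add: d_def power2_eq_square algebra_simps)
  then have d0: "0 < d" using assms by linarith
  have pq: "0 < p ^ 2 * q ^ 2" using assms by simp
  \<comment> \<open>Eliminate the \<open>27 A^2\<close> terms down to a multiple of \<open>d\<close>
    and complete the square in \<open>A\<close>; the remainder is free of \<open>A\<close>, which
    makes the gap uniform.\<close>
  have "p ^ 2 * q ^ 2 * (108 * (B - B')) =
      d * (3 * (3 * A + p ^ 2 * q ^ 2) ^ 2 + p ^ 2 * q ^ 2 * d ^ 2)"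
    using assms(1,2) unfolding flex_slope_eq_def d_def by algebra
  also have "\<dots> \<ge> d * (p ^ 2 * q ^ 2 * d ^ 2)"
    using d0 by (intro mult_left_mono) auto
  finally have "p ^ 2 * q ^ 2 * (d * d ^ 2) \<le> p ^ 2 * q ^ 2 * (108 * (B - B'))"
    by (simp add: mult_ac)
  then have "d * d ^ 2 \<le> 108 * (B - B')"
    using pq by (simp only: mult_le_cancel_left_pos)
  moreover have "1 * q ^ 2 \<le> d * d ^ 2"
    using d0 dq assms by (intro mult_mono power_mono) auto
  ultimately show ?thesis by linarith
qed

lemma flex_slope_eq_unique:
  fixes A B B' m :: int
  assumes "flex_slope_eq A B m" "flex_slope_eq A B' m" "m \<noteq> 0"
  shows "B = B'"
proof -
  have "m ^ 2 * (B - B') = 0"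
    using assms(1,2) unfolding flex_slope_eq_def by algebra
  then show ?thesis using assms(3) by simp
qed

text \<open>A slope determines its \<open>B\<close>, so choosing one slope per \<open>B\<close> is
  injective and a bound on the slopes bounds \<open>U\<close>.\<close>

lemma card_flex_slope_interval:
  fixes A a :: int and N :: nat
  assumes "N > 0" "U \<subseteq> {a..a + int N}"
    and slope: "\<And>B. B \<in> U \<Longrightarrow> \<exists>m::nat. m > 0 \<and> flex_slope_eq A B (int m)"
  shows "real (card U) \<le> 11 * sqrt (real N)"
proof -
  have fin: "finite U" using assms(2) finite_subset by blast
  obtain m :: "int \<Rightarrow> nat"
    where m: "\<And>B. B \<in> U \<Longrightarrow> m B > 0 \<and> flex_slope_eq A B (int (m B))"
    using slope by metis
  have inj: "inj_on m U"
  proof (rule inj_onI)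
    fix B B' assume "B \<in> U" "B' \<in> U" "m B = m B'"
    then show "B = B'"
      using m[of B] m[of B'] by (intro flex_slope_eq_unique[of A B "int (m B)" B']) auto
  qed
  have gap: "m B ^ 2 \<le> 108 * N" if "B \<in> U" "B' \<in> U" "m B' < m B" for B B'
  proof -
    have "int (m B) ^ 2 \<le> 108 * (B' - B)"
      using m that by (intro flex_slope_gap[of A B' "int (m B')" B]) auto
    also have "\<dots> \<le> 108 * int N"
      using subsetD[OF assms(2) that(1)] subsetD[OF assms(2) that(2)] by simp
    finally have "int (m B ^ 2) \<le> int (108 * N)" by simp
    then show ?thesis by (simp only: of_nat_le_iff)
  qed
  show ?thesis
  \<comment> \<open>The gap bounds a slope only by comparison with another one.\<close>
  proof (cases "card U \<le> 1")
    case True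
    then have "real (card U) \<le> 1" by simp
    also have "\<dots> \<le> sqrt (real N)" using assms(1) by simp
    also have "\<dots> \<le> 11 * sqrt (real N)" by simp
    finally show ?thesis .
  next
    case False
    \<comment> \<open>The factor 11 comes from \<open>108 \<le> 11^2\<close>.\<close>
    define k where "k = nat \<lfloor>11 * sqrt (real N)\<rfloor>"
    have "m B \<in> {1..k}" if B: "B \<in> U" for B
    proof -
      \<comment> \<open>Any second element bounds \<open>m B\<close>: directly if \<open>m B\<close>
        is the larger slope, otherwise through \<open>m B'\<close>.\<close>
      have "\<not> U \<subseteq> {B}"
        using False card_mono[of "{B}" U] by auto
      then obtain B' where B': "B' \<in> U" "B' \<noteq> B" by blast
      then have "m B' \<noteq> m B" using inj B by (auto dest: inj_onD)
      then have "m B ^ 2 \<le> 108 * N"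
      proof (cases "m B' < m B")
        case False
        then have lt: "m B < m B'" using \<open>m B' \<noteq> m B\<close> by simp
        then have "m B ^ 2 \<le> m B' ^ 2" by (simp add: power_mono)
        also have "\<dots> \<le> 108 * N" using gap B B' lt by blast
        finally show ?thesis .
      qed (use gap B B' in blast)
      then have "real (m B ^ 2) \<le> real (108 * N)" by (simp only: of_nat_le_iff)
      then have "real (m B) ^ 2 \<le> (11 * sqrt (real N)) ^ 2"
        by (simp add: power_mult_distrib)
      then have "real (m B) \<le> 11 * sqrt (real N)"
        by (rule power2_le_imp_le) simp
      then have "m B \<le> k" by (simp add: k_def le_nat_floor)
      then show ?thesis using m[OF B] by simp
    qed
    then have "card U \<le> card {1..k}"
      by (intro card_inj_on_le[OF inj]) auto
    then have "real (card U) \<le> real k" by simp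
    also have "\<dots> \<le> 11 * sqrt (real N)" by (simp add: k_def)
    finally show ?thesis .
  qed
qed

theorem proposition7p1:
  shows "\<exists>C::real. C > 0 \<and>
    (\<forall>M1 N1 M2 N2 :: nat. M1 > 0 \<longrightarrow> N1 > 0 \<longrightarrow> M2 > 0 \<longrightarrow> N2 > 0 \<longrightarrow>
      real (card {(A :: int, B :: int).
          int M1 \<le> \<bar>A\<bar> \<and> \<bar>A\<bar> \<le> int M1 + int N1 \<and>
          int M2 \<le> \<bar>B\<bar> \<and> \<bar>B\<bar> \<le> int M2 + int N2 \<and>
          defines_elliptic_curve (rat_of_int A) (rat_of_int B) \<and>
          ec_torsion (rat_of_int A) (rat_of_int B) 3 \<noteq> {Infinity}})
      \<le> C * (real N1 * real N2 / sqrt (real (min N1 N2))))"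
\<comment> \<open>\<open>88 = 4 * 2 * 11\<close>: at most \<open>4 * N1\<close> values of
  \<open>A\<close>, two signs of \<open>B\<close>, and \<open>11 * sqrt N2\<close> values of
  \<open>B\<close> for each sign.\<close>
proof (intro exI[of _ 88] conjI allI impI)
  fix M1 N1 M2 N2 :: nat
  assume pos: "M1 > 0" "N1 > 0" "M2 > 0" "N2 > 0"
  let ?S = "{(A :: int, B :: int).
          int M1 \<le> \<bar>A\<bar> \<and> \<bar>A\<bar> \<le> int M1 + int N1 \<and>
          int M2 \<le> \<bar>B\<bar> \<and> \<bar>B\<bar> \<le> int M2 + int N2 \<and>
          defines_elliptic_curve (rat_of_int A) (rat_of_int B) \<and>
          ec_torsion (rat_of_int A) (rat_of_int B) 3 \<noteq> {Infinity}}"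
  define I where "I = {int M1..int M1 + int N1} \<union> {- int M1 - int N1..- int M1}"
  define F where "F A = {B. \<exists>m::nat. m > 0 \<and> flex_slope_eq A B (int m)}" for A
  define V where "V A = F A \<inter> {int M2..int M2 + int N2}" for A
  define W where "W A = F A \<inter> {- int M2 - int N2..- int M2}" for A
  have fin: "finite I" "\<And>A. finite (V A \<union> W A)"
    by (auto simp: I_def V_def W_def)
  have sub: "?S \<subseteq> Sigma I (\<lambda>A. V A \<union> W A)"
  proof
    fix P assume P: "P \<in> ?S"
    obtain A B where AB: "P = (A, B)" by fastforce
    have A: "int M1 \<le> \<bar>A\<bar>" "\<bar>A\<bar> \<le> int M1 + int N1"
      and B: "int M2 \<le> \<bar>B\<bar>" "\<bar>B\<bar> \<le> int M2 + int N2"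
      and tors: "ec_torsion (rat_of_int A) (rat_of_int B) 3 \<noteq> {Infinity}"
      using P by (simp_all add: AB)
    \<comment> \<open>For \<open>A = 0\<close>, slope 0 would solve the equation with every
      \<open>B\<close>.\<close>
    have "A \<noteq> 0" using A(1) pos(1) by auto
    then have "B \<in> F A"
      using flex_slope_eq_torsion3_nat[OF tors] unfolding F_def by blast
    moreover have "A \<in> I" using A by (auto simp: I_def)
    ultimately show "P \<in> Sigma I (\<lambda>A. V A \<union> W A)"
      using B by (auto simp: AB V_def W_def)
  qed
  have fibre: "real (card (V A \<union> W A)) \<le> 22 * sqrt (real N2)" for A
  proof -
    have "real (card (V A)) \<le> 11 * sqrt (real N2)"
      using pos(4) by (intro card_flex_slope_interval[of N2 _ "int M2" A])
        (auto simp: V_def F_def)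
    moreover have "real (card (W A)) \<le> 11 * sqrt (real N2)"
      using pos(4) by (intro card_flex_slope_interval[of N2 _ "- int M2 - int N2" A])
        (auto simp: W_def F_def)
    moreover have "real (card (V A \<union> W A)) \<le> real (card (V A)) + real (card (W A))"
      using card_Un_le[of "V A" "W A"] by linarith
    ultimately show ?thesis by linarith
  qed
  have "card I \<le> 2 * (N1 + 1)"
    using card_Un_le[of "{int M1..int M1 + int N1}" "{- int M1 - int N1..- int M1}"]
    by (simp add: I_def)
  also have "\<dots> \<le> 4 * N1" using pos(2) by simp
  finally have cardI: "real (card I) \<le> 4 * real N1" by simp
  have "card ?S \<le> card (Sigma I (\<lambda>A. V A \<union> W A))"
    using fin by (intro card_mono sub finite_SigmaI)
  also have "\<dots> = (\<Sum>A\<in>I. card (V A \<union> W A))"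
    using fin by simp
  finally have "real (card ?S) \<le> (\<Sum>A\<in>I. real (card (V A \<union> W A)))"
    by (simp flip: of_nat_sum)
  also have "\<dots> \<le> real (card I) * (22 * sqrt (real N2))"
    by (intro sum_bounded_above fibre)
  also have "\<dots> \<le> (4 * real N1) * (22 * sqrt (real N2))"
    by (intro mult_right_mono cardI) simp
  also have "\<dots> = 88 * (real N1 * (real N2 / sqrt (real N2)))"
    by (simp add: real_div_sqrt)
  \<comment> \<open>Since \<open>min N1 N2 \<le> N2\<close>, the bound
    \<open>88 * N1 * sqrt N2\<close> is at least as strong as the claim.\<close>
  also have "\<dots> \<le> 88 * (real N1 * (real N2 / sqrt (real (min N1 N2))))"
    using pos by (intro mult_left_mono divide_left_mono) auto
  finally show "real (card ?S) \<le> 88 * (real N1 * real N2 / sqrt (real (min N1 N2)))"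
    by simp
qed simp

end
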